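(* Let $A_1,\dots,A_m\in\mathbb{S}^n$ be such that $I_n,A_1,\dots,A_m$ are linearly independent, let $\mathbf{b}\in\mathbb{R}^m$, let $f(\mathbf{y})=\log\operatorname{tr}\exp A(\mathbf{y})-\mathbf{b}^T\mathbf{y}$, and let $G_0$ be the centered Gram matrix of $A_1,\dots,A_m$. Then for every $\mathbf{y}\in\mathbb{R}^m$ one has $$\nabla^2 f(\mathbf{y})\preceq\tfrac12 G_0 .$$ In particular, $f$ is $\tfrac12\lambda_{\max}(G_0)$-smooth, i.e. $\nabla^2 f(\mathbf{y})\preceq\tfrac12\lambda_{\max}(G_0)I_m$ for all $\mathbf{y}\in\mathbb{R}^m$.
   Context: $\mathbb{S}^n$ is the space of real symmetric $n\times n$ matrices. $A(\mathbf{y})=\sum_{i=1}^m y_iA_i$. The centered Gram matrix is $G_0=[\operatorname{tr}(A_i^0A_j^0)]_{i,j=1}^m$, where $A_i^0=A_i-\tfrac{\operatorname{tr}A_i}{n}I_n$. $\lambda_{\max}$ denotes the largest eigenvalue. *)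

theory Defs
  imports "HOL-Analysis.Analysis"
begin

text \<open>
  \<^typ>\<open>real ^ 'n ^ 'n\<close> is not an instance of the normed-algebra classes on which \<^const>\<open>exp\<close> and
  \<^const>\<open>power\<close> are available, so powers and the exponential are defined with respect to
  the matrix product.
\<close>

primrec mat_power :: "real ^ 'n ^ 'n \<Rightarrow> nat \<Rightarrow> real ^ 'n ^ 'n" where
  "mat_power X 0 = mat 1"
| "mat_power X (Suc k) = X ** mat_power X k"

definition mat_exp :: "real ^ 'n ^ 'n \<Rightarrow> real ^ 'n ^ 'n" where
  "mat_exp X = (\<Sum>k. (1 / fact k) *\<^sub>R mat_power X k)"

definition symmetric_mat :: "real ^ 'n ^ 'n \<Rightarrow> bool" where
  "symmetric_mat X \<longleftrightarrow> transpose X = X"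

definition psd :: "real ^ 'n ^ 'n \<Rightarrow> bool" where
  "psd X \<longleftrightarrow> symmetric_mat X \<and> (\<forall>v. 0 \<le> v \<bullet> (X *v v))"

text \<open>The Loewner order compares symmetric matrices only.\<close>

definition loewner_le :: "real ^ 'n ^ 'n \<Rightarrow> real ^ 'n ^ 'n \<Rightarrow> bool" (infix "\<preceq>\<^sub>L" 50) where
  "X \<preceq>\<^sub>L Y \<longleftrightarrow> symmetric_mat X \<and> symmetric_mat Y \<and> psd (Y - X)"

definition eigenvalues :: "real ^ 'n ^ 'n \<Rightarrow> real set" where
  "eigenvalues X = {l. \<exists>v. v \<noteq> 0 \<and> X *v v = l *\<^sub>R v}"

text \<open>Meaningful for symmetric matrices, whose spectrum is real, finite and nonempty.\<close>

definition lambda_max :: "real ^ 'n ^ 'n \<Rightarrow> real" where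
  "lambda_max X = Max (eigenvalues X)"

definition mat_comb :: "('m::finite \<Rightarrow> real ^ 'n ^ 'n) \<Rightarrow> real ^ 'm \<Rightarrow> real ^ 'n ^ 'n" where
  "mat_comb A y = (\<Sum>i\<in>UNIV. (y $ i) *\<^sub>R A i)"

definition centered :: "real ^ 'n ^ 'n \<Rightarrow> real ^ 'n ^ 'n" where
  "centered X = X - (trace X / real CARD('n)) *\<^sub>R mat 1"

definition centered_gram :: "('m::finite \<Rightarrow> real ^ 'n ^ 'n) \<Rightarrow> real ^ 'm ^ 'm" where
  "centered_gram A = (\<chi> i j. trace (centered (A i) ** centered (A j)))"

definition log_tr_exp :: "('m::finite \<Rightarrow> real ^ 'n ^ 'n) \<Rightarrow> real ^ 'm \<Rightarrow> real ^ 'm \<Rightarrow> real" where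
  "log_tr_exp A b y = ln (trace (mat_exp (mat_comb A y))) - b \<bullet> y"

definition gradient :: "(real ^ 'm \<Rightarrow> real) \<Rightarrow> real ^ 'm \<Rightarrow> real ^ 'm" where
  "gradient f y = (\<chi> i. frechet_derivative f (at y) (axis i 1))"

definition hessian :: "(real ^ 'm \<Rightarrow> real) \<Rightarrow> real ^ 'm \<Rightarrow> real ^ 'm ^ 'm" where
  "hessian f y = jacobian (gradient f) (at y)"

text \<open>
  \<^const>\<open>frechet_derivative\<close> is total, so \<^const>\<open>gradient\<close> and \<^const>\<open>hessian\<close> carry their
  usual meaning only together with the following predicate.
\<close>

definition twice_differentiable :: "(real ^ 'm \<Rightarrow> real) \<Rightarrow> bool" where
  "twice_differentiable f \<longleftrightarrow>
     (\<forall>y. f differentiable (at y)) \<and> (\<forall>y. gradient f differentiable (at y))"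

definition L_smooth :: "real \<Rightarrow> (real ^ 'm \<Rightarrow> real) \<Rightarrow> bool" where
  "L_smooth L f \<longleftrightarrow> twice_differentiable f \<and> (\<forall>y. hessian f y \<preceq>\<^sub>L L *\<^sub>R mat 1)"

end

theory Submission
  imports Defs
begin

text \<open>
  Fix \<open>y\<close> and a direction \<open>v\<close>, and write \<open>X = A(y)\<close>, \<open>V = A(v)\<close>, \<open>Z = tr exp X\<close> and
  \<open>\<rho> = exp X / Z\<close>. With \<open>D\<close> the Frechet derivative of the matrix exponential at \<open>X\<close>, the quadratic form
  of the Hessian is \<open>tr (D(V) V) / Z - (tr (\<rho> V))\<^sup>2\<close>.

  In an eigenbasis of \<open>X\<close> with eigenvalues \<open>l\<close>, the derivative multiplies the entries of \<open>V\<close> by the divided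
  differences \<open>(exp (l i) - exp (l j)) / (l i - l j)\<close> (\<open>mat_exp_deriv_eigenvectors\<close>). Each of them is an
  average of \<open>exp\<close> over an interval and, by convexity, at most the mean of the values at the end points
  (\<open>exp_divdiff_le_mean\<close>). Therefore \<open>tr (D(V) V) \<le> tr (exp X V\<^sup>2)\<close> (\<open>trace_mat_exp_deriv_le\<close>), and the
  Hessian is bounded by the variance \<open>tr (\<rho> V\<^sup>2) - (tr (\<rho> V))\<^sup>2\<close>.

  In an eigenbasis of \<open>V\<close> this is the variance of the eigenvalues of \<open>V\<close> under a probability vector, hence
  at most a quarter of their squared range. The two extreme eigenvalues alone make the squared
  Frobenius norm of the centered \<open>V\<close> at least half of the squared range, so the variance is at most half
  that squared norm (\<open>gibbs_variance_le\<close>), which is the quadratic form of the centered Gram matrix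
  at \<open>v\<close> (\<open>centered_gram_form\<close>).

  Two general facts support this: the spectral theorem (\<open>symmetric_mat_spectral\<close>), and Frechet
  differentiability of the matrix exponential, obtained by differentiating its power series term by
  term (\<open>has_derivative_mat_exp\<close>). One application of the latter differentiates both the function and
  its gradient, because \<open>tr D(H) = tr (exp X H)\<close> already expresses the gradient through the exponential
  (\<open>trace_mat_exp_deriv\<close>).
\<close>

section \<open>The spectral theorem for real symmetric matrices\<close>

definition orthonormal_family :: "('n::finite \<Rightarrow> real ^ 'n) \<Rightarrow> bool" where
  "orthonormal_family u \<longleftrightarrow> (\<forall>i j. u i \<bullet> u j = (if i = j then 1 else 0))"

lemma orthonormal_family_inner:
  assumes "orthonormal_family u"
  shows "u i \<bullet> u j = (if i = j then 1 else 0)"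
  using assms by (simp add: orthonormal_family_def)

lemma orthonormal_family_matrix:
  fixes u :: "'n::finite \<Rightarrow> real ^ 'n"
  assumes "orthonormal_family u"
  defines "P \<equiv> (\<chi> i j. u j $ i)"
  shows "transpose P ** P = mat 1" "P ** transpose P = mat 1" "\<And>j. column j P = u j"
proof -
  show col: "column j P = u j" for j
    by (simp add: P_def column_def vec_eq_iff)
  show 1: "transpose P ** P = mat 1"
    by (simp add: matrix_mult_transpose_dot_column col orthonormal_family_inner[OF assms(1)] mat_def)
  then show "P ** transpose P = mat 1"
    using matrix_left_right_inverse by blast
qed

text \<open>
  The family is indexed by the coordinates themselves, so its vectors are the columns of a square
  matrix \<open>P\<close>. A left inverse of a square matrix is a right inverse, hence \<open>P ** transpose P\<close> is the
  identity; read on a vector, this is the expansion.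
\<close>

lemma orthonormal_family_expand:
  fixes u :: "'n::finite \<Rightarrow> real ^ 'n"
  assumes "orthonormal_family u"
  shows "x = (\<Sum>i\<in>UNIV. (u i \<bullet> x) *\<^sub>R u i)"
proof -
  define P where "P = (\<chi> i j. u j $ i)"
  note P = orthonormal_family_matrix[OF assms, folded P_def]
  have "x = P *v (transpose P *v x)"
    by (simp only: matrix_vector_mul_assoc P(2) matrix_vector_mul_lid)
  also have "\<dots> = (\<Sum>i\<in>UNIV. (transpose P *v x) $ i *s column i P)"
    by (simp add: matrix_mult_sum)
  also have "\<dots> = (\<Sum>i\<in>UNIV. (u i \<bullet> x) *\<^sub>R u i)"
    by (simp only: P(3) scalar_mult_eq_scaleR)
      (simp add: P_def matrix_vector_mul_component transpose_def inner_vec_def matrix_vector_mult_def vector_matrix_mult_def mult.commute)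
  finally show ?thesis .
qed

lemma orthonormal_family_inner_expand:
  fixes u :: "'n::finite \<Rightarrow> real ^ 'n"
  assumes "orthonormal_family u"
  shows "x \<bullet> y = (\<Sum>i\<in>UNIV. (u i \<bullet> x) * (u i \<bullet> y))"
  by (subst orthonormal_family_expand[OF assms, of x]) (simp add: inner_sum_left)

text \<open>
  Conjugation by the orthogonal matrix of the family leaves the trace unchanged, and the diagonal
  entries of the conjugated matrix are the terms of the sum.
\<close>

lemma trace_orthonormal_family:
  fixes u :: "'n::finite \<Rightarrow> real ^ 'n" and Y :: "real ^ 'n ^ 'n"
  assumes "orthonormal_family u"
  shows "trace Y = (\<Sum>i\<in>UNIV. u i \<bullet> (Y *v u i))"
proof -
  define P where "P = (\<chi> i j. u j $ i)"
  note P = orthonormal_family_matrix[OF assms, folded P_def]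
  have "trace Y = trace (Y ** (P ** transpose P))" by (simp add: P(2))
  also have "\<dots> = trace (transpose P ** (Y ** P))"
    by (simp add: matrix_mul_assoc trace_mul_sym[of _ "transpose P"])
  also have "\<dots> = (\<Sum>i\<in>UNIV. u i \<bullet> (Y *v u i))"
    unfolding trace_def
    by (rule sum.cong) (simp_all add: matrix_matrix_mult_def transpose_def P_def inner_vec_def matrix_vector_mult_def)
  finally show ?thesis .
qed

lemma symmetric_mat_inner:
  fixes X :: "real ^ 'n ^ 'n"
  assumes "symmetric_mat X"
  shows "x \<bullet> (X *v y) = (X *v x) \<bullet> y"
  by (metis assms dot_lmul_matrix symmetric_mat_def transpose_matrix_vector)

text \<open>
  First-order condition for the maximum. With \<open>l\<close> the maximal value, the quadratic form of
  \<open>l I - X\<close> is nonnegative on \<open>S\<close> and vanishes at \<open>u\<close>. Perturbing \<open>u\<close> in the direction of the residual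
  \<open>w = l u - X u\<close>, which stays in \<open>S\<close> by invariance, changes the form by \<open>2 t |w|\<^sup>2\<close> to first order, so
  \<open>w\<close> must be zero.
\<close>

lemma rayleigh_maximizer_eigenvector:
  fixes X :: "real ^ 'n ^ 'n"
  assumes sym: "symmetric_mat X" and S: "subspace S" and inv: "\<And>x. x \<in> S \<Longrightarrow> X *v x \<in> S"
    and u: "u \<in> S" "norm u = 1"
    and max: "\<And>x. x \<in> S \<Longrightarrow> norm x = 1 \<Longrightarrow> x \<bullet> (X *v x) \<le> u \<bullet> (X *v u)"
  shows "X *v u = (u \<bullet> (X *v u)) *\<^sub>R u"
proof -
  define l where "l = u \<bullet> (X *v u)"
  define w where "w = l *\<^sub>R u - X *v u"
  have wS: "w \<in> S"
    unfolding w_def using S u inv by (simp add: subspace_diff subspace_scale)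
  have form_nonneg: "0 \<le> l * (x \<bullet> x) - x \<bullet> (X *v x)" if "x \<in> S" for x
  proof (cases "x = 0")
    case False
    define y where "y = (1 / norm x) *\<^sub>R x"
    have "y \<bullet> (X *v y) \<le> l"
      unfolding l_def using that False S by (intro max) (auto simp: y_def subspace_scale)
    then have "x \<bullet> (X *v x) / (norm x)^2 \<le> l"
      by (simp add: y_def matrix_vector_mult_scaleR power2_eq_square)
    then show ?thesis
      using False by (simp add: divide_simps power2_norm_eq_inner split: if_splits)
  qed simp
  have uu: "u \<bullet> u = 1" using u by (simp add: norm_eq_1)
  have Xs: "w \<bullet> (X *v u) = u \<bullet> (X *v w)"
    using symmetric_mat_inner[OF sym] by (simp add: inner_commute)
  have uw: "u \<bullet> (X *v w) = l * (u \<bullet> w) - w \<bullet> w"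
    using Xs by (simp add: w_def inner_diff_left inner_diff_right inner_commute algebra_simps)
  define c where "c = l * (w \<bullet> w) - w \<bullet> (X *v w)"
  have pert: "0 \<le> 2 * t * (w \<bullet> w) + t^2 * c" for t :: real
  proof -
    have "u + t *\<^sub>R w \<in> S" using S u wS by (simp add: subspace_add subspace_scale)
    from form_nonneg[OF this] show ?thesis
      unfolding c_def
      by (simp add: Xs uu uw matrix_vector_right_distrib matrix_vector_mult_scaleR inner_add_left inner_add_right
          inner_commute[of w u] l_def[symmetric] power2_eq_square algebra_simps)
  qed
  have "w \<bullet> w = 0"
  proof (rule ccontr)
    assume "w \<bullet> w \<noteq> 0"
    then have pos: "w \<bullet> w > 0" by (simp add: inner_gt_zero_iff)
    \<comment> \<open>A negative step so short that the quadratic term cannot compensate the linear one.\<close>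
    define t where "t = - (w \<bullet> w) / (\<bar>c\<bar> + 1)"
    have "t < 0" using pos unfolding t_def by (simp add: divide_neg_pos)
    have "\<bar>t * c\<bar> < 2 * (w \<bullet> w)"
    proof -
      have "\<bar>t * c\<bar> = (w \<bullet> w) * (\<bar>c\<bar> / (\<bar>c\<bar> + 1))" using pos by (simp add: t_def abs_mult)
      also have "\<dots> \<le> (w \<bullet> w) * 1" using pos by (intro mult_left_mono) auto
      finally show ?thesis using pos by linarith
    qed
    then have "0 < 2 * (w \<bullet> w) + t * c" by linarith
    then have "t * (2 * (w \<bullet> w) + t * c) < 0" using \<open>t < 0\<close> by (simp add: mult_neg_pos)
    with pert[of t] show False by (simp add: power2_eq_square algebra_simps)
  qed
  then show ?thesis by (simp add: w_def l_def)
qed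

text \<open>
  A maximizer of the Rayleigh quotient on the unit sphere of \<open>S\<close> exists by compactness and is an
  eigenvector; its orthogonal complement in \<open>S\<close> is again invariant because \<open>X\<close> is self-adjoint, and has
  smaller dimension.
\<close>

lemma invariant_subspace_eigenbasis:
  fixes X :: "real ^ 'n ^ 'n"
  assumes sym: "symmetric_mat X" and "subspace S" and "\<And>x. x \<in> S \<Longrightarrow> X *v x \<in> S"
  shows "\<exists>B. finite B \<and> pairwise orthogonal B \<and> span B = S \<and>
             (\<forall>x\<in>B. norm x = 1 \<and> (\<exists>l. X *v x = l *\<^sub>R x))"
  using assms(2,3)
proof (induction "dim S" arbitrary: S rule: less_induct)
  case less
  note S = \<open>subspace S\<close>
  show ?case
  proof (cases "S = {0}")
    case True
    then show ?thesis by (intro exI[of _ "{}"]) auto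
  next
    case False
    then obtain z where z: "z \<in> S" "z \<noteq> 0" using subspace_0[OF S] by auto
    define K where "K = S \<inter> sphere 0 1"
    have "compact K" unfolding K_def
      by (intro closed_Int_compact closed_subspace S) auto
    moreover have "(1 / norm z) *\<^sub>R z \<in> K" using z S by (simp add: K_def subspace_scale)
    then have "K \<noteq> {}" by auto
    moreover have "continuous_on K (\<lambda>x. x \<bullet> (X *v x))"
      by (intro continuous_intros matrix_vector_mult_linear_continuous_on)
    ultimately obtain u where "u \<in> K" and maxK: "\<And>x. x \<in> K \<Longrightarrow> x \<bullet> (X *v x) \<le> u \<bullet> (X *v u)"
      using continuous_attains_sup[of K "\<lambda>x. x \<bullet> (X *v x)"] by blast
    then have u: "u \<in> S" "norm u = 1" by (auto simp: K_def)
    have "X *v u = (u \<bullet> (X *v u)) *\<^sub>R u"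
      using maxK by (intro rayleigh_maximizer_eigenvector[OF sym S less.prems(2) u]) (auto simp: K_def)
    then obtain l where l: "X *v u = l *\<^sub>R u" by blast
    define T where "T = S \<inter> {x. u \<bullet> x = 0}"
    have subT: "subspace T"
      unfolding T_def using S subspace_hyperplane by (rule subspace_inter)
    have invT: "X *v x \<in> T" if "x \<in> T" for x
      using that less.prems(2) by (auto simp: T_def symmetric_mat_inner[OF sym] l)
    have "u \<notin> T" using u by (simp add: T_def norm_eq_1)
    then have "T \<subset> S" using u unfolding T_def by blast
    then have "dim T < dim S"
      using S subT by (intro dim_psubset) (simp add: span_eq_iff[THEN iffD2])
    from less.hyps[OF this subT invT]
    obtain B where B: "finite B" "pairwise orthogonal B" "span B = T"
      "\<forall>x\<in>B. norm x = 1 \<and> (\<exists>l. X *v x = l *\<^sub>R x)" by blast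
    have BT: "B \<subseteq> T" using B(3) span_superset by blast
    have "span (insert u B) = S"
    proof
      show "span (insert u B) \<subseteq> S"
        using BT u by (intro span_minimal S) (auto simp: T_def)
      show "S \<subseteq> span (insert u B)"
      proof
        fix x assume "x \<in> S"
        then have "x - (u \<bullet> x) *\<^sub>R u \<in> T"
          using S u by (auto simp: T_def subspace_diff subspace_scale inner_diff_right norm_eq_1)
        then show "x \<in> span (insert u B)" using B(3) span_breakdown_eq by blast
      qed
    qed
    moreover have "pairwise orthogonal (insert u B)"
      using B(2) BT by (auto simp: pairwise_insert orthogonal_def T_def inner_commute)
    ultimately show ?thesis
      using B u l by (intro exI[of _ "insert u B"]) auto
  qed
qed

proposition symmetric_mat_spectral:
  fixes X :: "real ^ 'n ^ 'n"
  assumes "symmetric_mat X"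
  obtains u l where "orthonormal_family u" "\<And>i. X *v u i = l i *\<^sub>R u i"
proof -
  obtain B where B: "finite B" "pairwise orthogonal B" "span B = (UNIV :: (real^'n) set)"
    and ev: "\<forall>x\<in>B. norm x = 1 \<and> (\<exists>l. X *v x = l *\<^sub>R x)"
    using invariant_subspace_eigenbasis[OF assms subspace_UNIV] by blast
  have "0 \<notin> B" using ev by auto
  then have "independent B" using B(2) by (rule pairwise_orthogonal_independent[rotated])
  then have "card B = CARD('n)"
    using B(3) dim_eq_card_independent[of B] dim_span[of B] by simp
  then obtain u where u: "bij_betw u (UNIV :: 'n set) B"
    using finite_same_card_bij[of "UNIV :: 'n set" B] B(1) by auto
  have uB: "u i \<in> B" for i using u by (auto simp: bij_betw_def)
  have "orthonormal_family u"
    unfolding orthonormal_family_def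
  proof (intro allI)
    fix i j
    show "u i \<bullet> u j = (if i = j then 1 else 0)"
    proof (cases "i = j")
      case True
      then show ?thesis using ev uB[of j] by (simp add: norm_eq_1)
    next
      case False
      then have "u i \<noteq> u j" using bij_betw_imp_inj_on[OF u] by (simp add: inj_eq)
      then show ?thesis using B(2) uB[of i] uB[of j] False by (simp add: pairwise_def orthogonal_def)
    qed
  qed
  moreover have "\<forall>i. \<exists>l. X *v u i = l *\<^sub>R u i"
    using ev uB by blast
  then obtain l where "\<forall>i. X *v u i = l i *\<^sub>R u i"
    by (rule choice[THEN exE])
  ultimately show ?thesis by (intro that) auto
qed

section \<open>The Frechet derivative of the matrix exponential\<close>

lemma norm_matrix_sq:
  fixes A :: "real ^ 'n ^ 'm"
  shows "(norm A)\<^sup>2 = (\<Sum>i\<in>UNIV. (norm (A $ i))\<^sup>2)"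
  by (simp add: power2_norm_eq_inner inner_vec_def)

lemma norm_matrix_sq_entries:
  fixes A :: "real ^ 'n ^ 'm"
  shows "(norm A)\<^sup>2 = (\<Sum>i\<in>UNIV. \<Sum>j\<in>UNIV. (A $ i $ j)\<^sup>2)"
  unfolding power2_norm_eq_inner by (simp add: inner_vec_def power2_eq_square)

text \<open>
  The norm of \<^typ>\<open>real ^ 'n ^ 'm\<close> is the Frobenius norm. Each entry of the product is the inner
  product of a row and a column, so this is the Cauchy--Schwarz inequality, squared and summed.
\<close>

lemma norm_matrix_mult_le:
  fixes A :: "real ^ 'n ^ 'm" and B :: "real ^ 'k ^ 'n"
  shows "norm (A ** B) \<le> norm A * norm B"
proof (rule power2_le_imp_le)
  have entry: "(A ** B) $ i $ j = A $ i \<bullet> column j B" for i j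
    by (simp add: matrix_matrix_mult_def inner_vec_def column_def)
  have "(norm (A ** B))\<^sup>2 = (\<Sum>i\<in>UNIV. \<Sum>j\<in>UNIV. (A $ i \<bullet> column j B)\<^sup>2)"
    by (simp add: norm_matrix_sq_entries entry)
  also have "\<dots> \<le> (\<Sum>i\<in>UNIV. \<Sum>j\<in>UNIV. (norm (A $ i))\<^sup>2 * (norm (column j B))\<^sup>2)"
    unfolding power2_norm_eq_inner by (intro sum_mono Cauchy_Schwarz_ineq)
  also have "\<dots> = (norm A)\<^sup>2 * (\<Sum>j\<in>UNIV. (norm (column j B))\<^sup>2)"
    by (simp add: norm_matrix_sq sum_product)
  also have "(\<Sum>j\<in>UNIV. (norm (column j B))\<^sup>2) = (\<Sum>j\<in>UNIV. \<Sum>i\<in>UNIV. (B $ i $ j)\<^sup>2)"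
    unfolding power2_norm_eq_inner by (simp add: inner_vec_def column_def power2_eq_square)
  also have "\<dots> = (norm B)\<^sup>2"
    unfolding norm_matrix_sq_entries by (rule sum.swap)
  finally show "(norm (A ** B))\<^sup>2 \<le> (norm A * norm B)\<^sup>2"
    by (simp add: power_mult_distrib)
qed simp

lemma bounded_bilinear_matrix_mult:
  "bounded_bilinear (\<lambda>(A :: real ^ 'n ^ 'm) (B :: real ^ 'k ^ 'n). A ** B)"
proof
  show "\<exists>K. \<forall>A B. norm ((A :: real ^ 'n ^ 'm) ** (B :: real ^ 'k ^ 'n)) \<le> norm A * norm B * K"
    by (intro exI[of _ 1]) (simp add: norm_matrix_mult_le)
qed (auto simp: matrix_matrix_mult_def vec_eq_iff distrib_right distrib_left sum.distrib sum_distrib_left mult_ac)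

lemma bounded_linear_matrix_vector_mult_left:
  "bounded_linear (\<lambda>A :: real ^ 'n ^ 'm. A *v v)"
  by (unfold linear_conv_bounded_linear[symmetric], rule linearI)
    (simp_all add: matrix_vector_mult_add_rdistrib scaleR_matrix_vector_assoc)

lemma bounded_linear_trace: "bounded_linear (trace :: real ^ 'n ^ 'n \<Rightarrow> real)"
  by (unfold linear_conv_bounded_linear[symmetric], rule linearI)
    (simp_all add: trace_def sum.distrib sum_distrib_left)

lemma norm_mat_power_le:
  fixes X :: "real ^ 'n ^ 'n"
  assumes "norm X \<le> R"
  shows "norm (mat_power X k) \<le> norm (mat 1 :: real ^ 'n ^ 'n) * R ^ k"
proof (induction k)
  case (Suc k)
  have "norm (mat_power X (Suc k)) \<le> norm X * norm (mat_power X k)"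
    by (simp add: norm_matrix_mult_le)
  also have "\<dots> \<le> R * (norm (mat 1 :: real ^ 'n ^ 'n) * R ^ k)"
    using assms Suc by (intro mult_mono) (auto intro: order_trans[OF norm_ge_zero])
  finally show ?case by (simp add: mult_ac)
qed simp

lemma summable_mat_exp: "summable (\<lambda>k. (1 / fact k) *\<^sub>R mat_power (X :: real ^ 'n ^ 'n) k)"
proof (rule summable_comparison_test')
  show "summable (\<lambda>k. norm (mat 1 :: real ^ 'n ^ 'n) * (norm X ^ k /\<^sub>R fact k))"
    by (intro summable_mult summable_exp_generic)
  show "norm ((1 / fact k) *\<^sub>R mat_power X k) \<le> norm (mat 1 :: real ^ 'n ^ 'n) * (norm X ^ k /\<^sub>R fact k)"
    if "k \<ge> 0" for k
    using norm_mat_power_le[of X "norm X" k] by (simp add: divide_simps)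
qed

lemma mat_exp_sums: "(\<lambda>k. (1 / fact k) *\<^sub>R mat_power X k) sums mat_exp X"
  unfolding mat_exp_def by (rule summable_sums[OF summable_mat_exp])

text \<open>
  The derivative of the \<open>k\<close>-th power at \<open>X\<close> in direction \<open>H\<close>, that is the sum of \<open>X\<^sup>p H X\<^sup>q\<close> over
  \<open>p + q = k - 1\<close>. The recursion is the product rule; it avoids working with the double-indexed sum.
\<close>

primrec mat_power_deriv :: "real ^ 'n ^ 'n \<Rightarrow> nat \<Rightarrow> real ^ 'n ^ 'n \<Rightarrow> real ^ 'n ^ 'n" where
  "mat_power_deriv X 0 H = 0"
| "mat_power_deriv X (Suc k) H = X ** mat_power_deriv X k H + H ** mat_power X k"

definition mat_exp_deriv :: "real ^ 'n ^ 'n \<Rightarrow> real ^ 'n ^ 'n \<Rightarrow> real ^ 'n ^ 'n" where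
  "mat_exp_deriv X H = (\<Sum>k. (1 / fact k) *\<^sub>R mat_power_deriv X k H)"

lemma has_derivative_mat_power:
  "((\<lambda>X. mat_power X k) has_derivative mat_power_deriv X k) (at X within S)"
proof (induction k)
  case 0
  have "mat_power_deriv X 0 = (\<lambda>_. 0)" by auto
  then show ?case by simp
next
  case (Suc k)
  from bounded_bilinear.FDERIV[OF bounded_bilinear_matrix_mult has_derivative_ident Suc]
  show ?case by simp
qed

text \<open>
  The natural bound has the factor \<open>k R\<^sup>k\<^sup>-\<^sup>1\<close>. The cruder \<open>(2 R)\<^sup>k\<close>, which is where \<open>R\<close> has to be
  at least 1, turns the majorant of the differentiated series into an exponential series.
\<close>

lemma norm_mat_power_deriv_le:
  fixes X :: "real ^ 'n ^ 'n"
  assumes "norm X \<le> R" "1 \<le> R"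
  shows "norm (mat_power_deriv X k H) \<le> norm (mat 1 :: real ^ 'n ^ 'n) * (2 * R) ^ k * norm H"
proof (induction k)
  case (Suc k)
  let ?N = "norm (mat 1 :: real ^ 'n ^ 'n)"
  have "norm (mat_power_deriv X (Suc k) H) \<le> norm X * norm (mat_power_deriv X k H) + norm H * norm (mat_power X k)"
    by (simp add: norm_triangle_le add_mono norm_matrix_mult_le)
  also have "\<dots> \<le> R * (?N * (2 * R) ^ k * norm H) + norm H * (?N * R ^ k)"
    using assms Suc norm_mat_power_le[OF assms(1)] by (intro add_mono mult_mono) auto
  also have "\<dots> \<le> R * (?N * (2 * R) ^ k * norm H) + norm H * (?N * (R * (2 * R) ^ k))"
  proof -
    have "1 * R ^ k \<le> R * (2 * R) ^ k"
      using assms(2) by (intro mult_mono power_mono) auto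
    then show ?thesis by (intro add_left_mono mult_left_mono) auto
  qed
  finally show ?case by (simp add: algebra_simps)
qed simp

lemma
  fixes X :: "real ^ 'n ^ 'n"
  assumes R: "norm X \<le> R" "1 \<le> R"
  defines "c \<equiv> \<lambda>k. norm (mat 1 :: real ^ 'n ^ 'n) * ((2 * R) ^ k /\<^sub>R fact k)"
  shows norm_mat_exp_deriv_term_le: "norm ((1 / fact k) *\<^sub>R mat_power_deriv X k H) \<le> c k * norm H"
    and summable_mat_exp_deriv_majorant: "summable c"
proof -
  show "summable c"
    unfolding c_def by (intro summable_mult summable_exp_generic)
  show "norm ((1 / fact k) *\<^sub>R mat_power_deriv X k H) \<le> c k * norm H"
    using norm_mat_power_deriv_le[OF R, of k H] by (simp add: c_def divide_simps mult_ac)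
qed

lemma mat_exp_deriv_sums:
  "(\<lambda>k. (1 / fact k) *\<^sub>R mat_power_deriv X k H) sums mat_exp_deriv X H"
  unfolding mat_exp_deriv_def
proof (rule summable_sums, rule summable_comparison_test')
  have R: "norm X \<le> max 1 (norm X)" "1 \<le> max 1 (norm X)" by auto
  show "summable (\<lambda>k. norm (mat 1 :: real ^ 'a ^ 'a) * ((2 * max 1 (norm X)) ^ k /\<^sub>R fact k) * norm H)"
    by (rule summable_mult2[OF summable_mat_exp_deriv_majorant[OF R]])
  show "norm ((1 / fact k) *\<^sub>R mat_power_deriv X k H)
      \<le> norm (mat 1 :: real ^ 'a ^ 'a) * ((2 * max 1 (norm X)) ^ k /\<^sub>R fact k) * norm H"
    if "k \<ge> 0" for k
    by (rule norm_mat_exp_deriv_term_le[OF R])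
qed

text \<open>
  Termwise differentiation of the power series on the ball of radius \<open>|X| + 1\<close>. The tails of the
  differentiated series are bounded, uniformly on that ball, by the tails of an exponential series.
\<close>

proposition has_derivative_mat_exp:
  fixes X :: "real ^ 'n ^ 'n"
  shows "(mat_exp has_derivative mat_exp_deriv X) (at X)"
proof -
  define R where "R = norm X + 1"
  define S where "S = ball (0 :: real ^ 'n ^ 'n) R"
  define c where "c = (\<lambda>k. norm (mat 1 :: real ^ 'n ^ 'n) * ((2 * R) ^ k /\<^sub>R fact k))"
  have R: "1 \<le> R" and XS: "X \<in> S" by (auto simp: R_def S_def)
  have nR: "norm Y \<le> R" if "Y \<in> S" for Y using that by (simp add: S_def)
  have c: "summable c"
    unfolding c_def using nR[OF XS] R by (rule summable_mat_exp_deriv_majorant)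
  have "\<exists>g. \<forall>Y\<in>S. (\<lambda>k. (1 / fact k) *\<^sub>R mat_power Y k) sums g Y \<and>
             (g has_derivative mat_exp_deriv Y) (at Y within S)"
  proof (rule has_derivative_series[where f' = "\<lambda>k Y H. (1 / fact k) *\<^sub>R mat_power_deriv Y k H" and x = X])
    show "convex S" by (simp add: S_def)
    show "X \<in> S" by (rule XS)
    show "(\<lambda>k. (1 / fact k) *\<^sub>R mat_power X k) sums mat_exp X" by (rule mat_exp_sums)
    show "((\<lambda>Y. (1 / fact k) *\<^sub>R mat_power Y k) has_derivative (\<lambda>H. (1 / fact k) *\<^sub>R mat_power_deriv Y k H)) (at Y within S)"
      for k Y by (intro has_derivative_scaleR_right has_derivative_mat_power)
    fix e :: real assume "e > 0"
    then obtain M where M: "\<And>n. n \<ge> M \<Longrightarrow> norm (\<Sum>k. c (k + n)) < e"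
      using suminf_exist_split[OF _ c] by blast
    show "\<forall>\<^sub>F n in sequentially. \<forall>Y\<in>S. \<forall>H.
      norm ((\<Sum>k<n. (1 / fact k) *\<^sub>R mat_power_deriv Y k H) - mat_exp_deriv Y H) \<le> e * norm H"
      unfolding eventually_sequentially
    proof (intro exI allI impI ballI)
      fix n Y H assume n: "M \<le> n" and Y: "Y \<in> S"
      define T where "T = (\<lambda>k. (1 / fact k) *\<^sub>R mat_power_deriv Y k H)"
      have T: "T sums mat_exp_deriv Y H" unfolding T_def by (rule mat_exp_deriv_sums)
      have "norm ((\<Sum>k<n. T k) - mat_exp_deriv Y H) = norm (\<Sum>k. T (k + n))"
        using suminf_minus_initial_segment[OF sums_summable[OF T], of n] sums_unique[OF T]
        by (simp add: norm_minus_commute)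
      also have "\<dots> \<le> (\<Sum>k. c (k + n) * norm H)"
        using c norm_mat_exp_deriv_term_le[OF nR[OF Y] R]
        by (intro norm_suminf_le summable_mult2 summable_ignore_initial_segment) (auto simp: T_def c_def)
      also have "\<dots> = (\<Sum>k. c (k + n)) * norm H"
        using c by (intro suminf_mult2[symmetric] summable_ignore_initial_segment)
      also have "\<dots> \<le> e * norm H"
        using M[OF n] by (intro mult_right_mono) auto
      finally show "norm ((\<Sum>k<n. (1 / fact k) *\<^sub>R mat_power_deriv Y k H) - mat_exp_deriv Y H) \<le> e * norm H"
        by (simp add: T_def)
    qed
  qed
  then obtain g where g: "\<And>Y. Y \<in> S \<Longrightarrow> (\<lambda>k. (1 / fact k) *\<^sub>R mat_power Y k) sums g Y"
      "\<And>Y. Y \<in> S \<Longrightarrow> (g has_derivative mat_exp_deriv Y) (at Y within S)" by blast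
  have "(g has_derivative mat_exp_deriv X) (at X)"
    using g(2)[OF XS] XS by (simp add: S_def at_within_open[OF _ open_ball])
  moreover have "g Y = mat_exp Y" if "Y \<in> S" for Y
    using sums_unique2[OF g(1)[OF that] mat_exp_sums] .
  ultimately show ?thesis
    using has_derivative_transform_within_open[of g _ X UNIV S mat_exp] XS by (simp add: S_def)
qed

section \<open>The exponential and its derivative in an eigenbasis\<close>

lemma mat_power_eigenvector:
  assumes "X *v v = a *\<^sub>R v"
  shows "mat_power X k *v v = a ^ k *\<^sub>R v"
proof (induction k)
  case (Suc k)
  have "mat_power X (Suc k) *v v = X *v (mat_power X k *v v)"
    by (simp add: matrix_vector_mul_assoc)
  then show ?case using assms Suc by (simp add: matrix_vector_mult_scaleR mult.commute)
qed simp

lemma mat_exp_eigenvector: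
  assumes "X *v v = a *\<^sub>R v"
  shows "mat_exp X *v v = exp a *\<^sub>R v"
proof -
  have "(\<lambda>k. ((1 / fact k) *\<^sub>R mat_power X k) *v v) sums (mat_exp X *v v)"
    by (rule bounded_linear.sums[OF bounded_linear_matrix_vector_mult_left mat_exp_sums])
  moreover have "(\<lambda>k. ((1 / fact k) *\<^sub>R mat_power X k) *v v) = (\<lambda>k. (a ^ k /\<^sub>R fact k) *\<^sub>R v)"
    by (simp add: scaleR_matrix_vector_assoc[symmetric] mat_power_eigenvector[OF assms] divide_inverse mult.commute)
  ultimately have "(\<lambda>k. (a ^ k /\<^sub>R fact k) *\<^sub>R v) sums (mat_exp X *v v)" by simp
  moreover have "(\<lambda>k. (a ^ k /\<^sub>R fact k) *\<^sub>R v) sums (exp a *\<^sub>R v)"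
    by (intro sums_scaleR_left exp_converges)
  ultimately show ?thesis by (rule sums_unique2)
qed

text \<open>
  The divided difference \<open>(a\<^sup>k - b\<^sup>k) / (a - b)\<close>, extended to \<open>a = b\<close>. The recursion matches the one of
  \<^const>\<open>mat_power_deriv\<close> term by term when the outer vectors are eigenvectors for \<open>a\<close> and \<open>b\<close>.
\<close>

primrec power_divdiff :: "real \<Rightarrow> real \<Rightarrow> nat \<Rightarrow> real" where
  "power_divdiff a b 0 = 0"
| "power_divdiff a b (Suc k) = a * power_divdiff a b k + b ^ k"

definition exp_divdiff :: "real \<Rightarrow> real \<Rightarrow> real" where
  "exp_divdiff a b = (if a = b then exp a else (exp a - exp b) / (a - b))"

lemma power_divdiff_diff: "(a - b) * power_divdiff a b k = a ^ k - b ^ k"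
proof (induction k)
  case (Suc k)
  have "(a - b) * power_divdiff a b (Suc k) = a * ((a - b) * power_divdiff a b k) + (a - b) * b ^ k"
    by (simp add: algebra_simps)
  then show ?case unfolding Suc by (simp add: algebra_simps)
qed simp

lemma power_divdiff_same: "power_divdiff a a (Suc k) = real (Suc k) * a ^ k"
  by (induction k) (simp_all add: algebra_simps)

lemma exp_divdiff_sums: "(\<lambda>k. power_divdiff a b k / fact k) sums exp_divdiff a b"
proof (cases "a = b")
  case True
  have "power_divdiff a b (Suc k) / fact (Suc k) = a ^ k /\<^sub>R fact k" for k
  proof -
    have "power_divdiff a b (Suc k) / fact (Suc k) = (real (Suc k) * a ^ k) / (real (Suc k) * fact k)"
      unfolding True power_divdiff_same fact_Suc ..
    then show ?thesis by (simp add: divide_inverse mult.commute)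
  qed
  then have "(\<lambda>k. power_divdiff a b (Suc k) / fact (Suc k)) sums exp_divdiff a b"
    using exp_converges[of a] by (simp add: exp_divdiff_def True)
  then show ?thesis by (subst (asm) sums_Suc_iff) simp
next
  case False
  have "(\<lambda>k. (a ^ k /\<^sub>R fact k - b ^ k /\<^sub>R fact k) / (a - b)) sums ((exp a - exp b) / (a - b))"
    by (intro sums_divide sums_diff exp_converges)
  moreover have "(a ^ k /\<^sub>R fact k - b ^ k /\<^sub>R fact k) / (a - b) = power_divdiff a b k / fact k" for k
  proof -
    have "(a ^ k /\<^sub>R fact k - b ^ k /\<^sub>R fact k) / (a - b) = (a ^ k - b ^ k) / fact k / (a - b)"
      by (simp add: divide_inverse algebra_simps)
    also have "\<dots> = power_divdiff a b k / fact k"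
      unfolding power_divdiff_diff[symmetric] using False by simp
    finally show ?thesis .
  qed
  ultimately show ?thesis using False by (simp add: exp_divdiff_def)
qed

lemma exp_divdiff_commute: "exp_divdiff a b = exp_divdiff b a"
  by (simp add: exp_divdiff_def) (metis minus_diff_eq minus_divide_divide)

text \<open>
  The divided difference is the average of \<open>exp\<close> over the interval between \<open>a\<close> and \<open>b\<close>, and by convexity
  the trapezoidal rule overestimates it (Hermite--Hadamard). After division by the smaller exponential
  only one real variable \<open>t = a - b\<close> remains, and the inequality follows by differentiating in it.
\<close>

lemma exp_divdiff_le_mean: "exp_divdiff a b \<le> (exp a + exp b) / 2"
proof -
  have trapezoid: "exp t - 1 \<le> t * (exp t + 1) / 2" if "t \<ge> 0" for t :: real
  proof -
    have "0 * (exp 0 + 1) / 2 - exp 0 + 1 \<le> t * (exp t + 1) / 2 - exp t + (1::real)"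
    proof (rule DERIV_nonneg_imp_nondecreasing[OF that])
      fix x :: real
      have "((\<lambda>x. x * (exp x + 1) / 2 - exp x + 1) has_real_derivative
              (exp x * (x - 1) + 1) / 2) (at x)"
        by (auto intro!: derivative_eq_intros simp: field_simps)
      moreover have "exp x * (1 - x) \<le> exp x * exp (- x)"
        using exp_ge_add_one_self[of "- x"] by (intro mult_left_mono) auto
      then have "0 \<le> (exp x * (x - 1) + 1) / 2"
        by (simp add: exp_minus algebra_simps)
      ultimately show "\<exists>y. ((\<lambda>x. x * (exp x + 1) / 2 - exp x + 1) has_real_derivative y) (at x) \<and> 0 \<le> y"
        by blast
    qed
    then show ?thesis by simp
  qed
  have *: "exp_divdiff a b \<le> (exp a + exp b) / 2" if "b < a" for a b :: real
  proof -
    have e: "exp a = exp b * exp (a - b)" by (simp add: exp_diff)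
    have "exp b * (exp (a - b) - 1) \<le> exp b * ((a - b) * (exp (a - b) + 1) / 2)"
      using that by (intro mult_left_mono trapezoid) auto
    then have "exp a - exp b \<le> (a - b) * (exp a + exp b) / 2"
      unfolding e by (simp add: algebra_simps)
    then show ?thesis using that by (simp add: exp_divdiff_def divide_simps mult.commute)
  qed
  show ?thesis
  proof (cases a b rule: linorder_cases)
    case less
    then show ?thesis using *[OF less] exp_divdiff_commute[of a b] by (simp add: add.commute)
  next
    case equal
    then show ?thesis by (simp add: exp_divdiff_def)
  next
    case greater
    then show ?thesis by (rule *)
  qed
qed

lemma mat_power_deriv_eigenvectors:
  assumes sym: "symmetric_mat X" and v: "X *v v = a *\<^sub>R v" and w: "X *v w = b *\<^sub>R w"
  shows "v \<bullet> (mat_power_deriv X k H *v w) = power_divdiff a b k * (v \<bullet> (H *v w))"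
proof (induction k)
  case (Suc k)
  have "v \<bullet> (mat_power_deriv X (Suc k) H *v w)
      = v \<bullet> (X *v (mat_power_deriv X k H *v w)) + v \<bullet> (H *v (mat_power X k *v w))"
    by (simp add: matrix_vector_mul_assoc matrix_vector_mult_add_rdistrib inner_add_right)
  also have "v \<bullet> (X *v (mat_power_deriv X k H *v w)) = a * (v \<bullet> (mat_power_deriv X k H *v w))"
    by (simp add: symmetric_mat_inner[OF sym] v)
  finally show ?case
    by (simp add: Suc mat_power_eigenvector[OF w] matrix_vector_mult_scaleR algebra_simps)
qed simp

text \<open>
  In an eigenbasis of \<open>X\<close> the derivative of the exponential multiplies the entries of the direction
  \<open>H\<close> by divided differences of \<open>exp\<close> (the Daleckii--Krein formula). Summing the same fact for powers
  proves it.
\<close>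

lemma mat_exp_deriv_eigenvectors:
  assumes "symmetric_mat X" and "X *v v = a *\<^sub>R v" and "X *v w = b *\<^sub>R w"
  shows "v \<bullet> (mat_exp_deriv X H *v w) = exp_divdiff a b * (v \<bullet> (H *v w))"
proof -
  have "bounded_linear (\<lambda>Y. v \<bullet> (Y *v w))"
    by (intro bounded_linear_compose[OF bounded_linear_inner_right] bounded_linear_matrix_vector_mult_left)
  from bounded_linear.sums[OF this mat_exp_deriv_sums[of X H]]
  have "(\<lambda>k. v \<bullet> (((1 / fact k) *\<^sub>R mat_power_deriv X k H) *v w)) sums (v \<bullet> (mat_exp_deriv X H *v w))" .
  moreover have "(\<lambda>k. v \<bullet> (((1 / fact k) *\<^sub>R mat_power_deriv X k H) *v w))
      = (\<lambda>k. power_divdiff a b k / fact k * (v \<bullet> (H *v w)))"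
    by (simp add: scaleR_matrix_vector_assoc[symmetric] mat_power_deriv_eigenvectors[OF assms])
  ultimately have "(\<lambda>k. power_divdiff a b k / fact k * (v \<bullet> (H *v w))) sums (v \<bullet> (mat_exp_deriv X H *v w))"
    by simp
  moreover have "(\<lambda>k. power_divdiff a b k / fact k * (v \<bullet> (H *v w))) sums (exp_divdiff a b * (v \<bullet> (H *v w)))"
    by (intro sums_mult2 exp_divdiff_sums)
  ultimately show ?thesis by (rule sums_unique2)
qed

lemma inner_matrix_vector_expand:
  fixes u :: "'n::finite \<Rightarrow> real ^ 'n" and Y :: "real ^ 'n ^ 'n"
  assumes "orthonormal_family u"
  shows "v \<bullet> (Y *v w) = (\<Sum>j\<in>UNIV. (v \<bullet> (Y *v u j)) * (u j \<bullet> w))"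
proof -
  have "v \<bullet> (Y *v w) = (v v* Y) \<bullet> w" by (simp add: dot_lmul_matrix)
  also have "\<dots> = (\<Sum>j\<in>UNIV. (u j \<bullet> (v v* Y)) * (u j \<bullet> w))"
    by (rule orthonormal_family_inner_expand[OF assms])
  finally show ?thesis by (simp add: inner_commute[of "u _" "v v* Y"] dot_lmul_matrix)
qed

text \<open>
  Here \<open>X\<close> is given together with an eigenbasis, in which the traces are computed. The versions that do
  not mention the basis come after the context, where the spectral theorem supplies one.
\<close>

context
  fixes X :: "real ^ 'n ^ 'n" and u :: "'n \<Rightarrow> real ^ 'n" and l :: "'n \<Rightarrow> real"
  assumes sym: "symmetric_mat X" and u: "orthonormal_family u" and eig: "\<And>i. X *v u i = l i *\<^sub>R u i"
begin

lemma trace_mat_exp_mult_eigenbasis: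
  "trace (mat_exp X ** H) = (\<Sum>i\<in>UNIV. exp (l i) * (u i \<bullet> (H *v u i)))"
proof -
  have "trace (mat_exp X ** H) = trace (H ** mat_exp X)" by (rule trace_mul_sym)
  also have "\<dots> = (\<Sum>i\<in>UNIV. u i \<bullet> (H *v (mat_exp X *v u i)))"
    by (simp add: trace_orthonormal_family[OF u] matrix_vector_mul_assoc)
  finally show ?thesis by (simp add: mat_exp_eigenvector[OF eig] matrix_vector_mult_scaleR)
qed

lemma trace_mat_exp_eigenbasis: "trace (mat_exp X) = (\<Sum>i\<in>UNIV. exp (l i))"
  using trace_mat_exp_mult_eigenbasis[of "mat 1"] by (simp add: orthonormal_family_inner[OF u])

text \<open>
  Only the diagonal entries enter the trace, and there the divided difference is \<open>exp\<close> itself.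
\<close>

lemma trace_mat_exp_deriv_eigenbasis: "trace (mat_exp_deriv X H) = trace (mat_exp X ** H)"
  by (simp add: trace_mat_exp_mult_eigenbasis trace_orthonormal_family[OF u, of "mat_exp_deriv X H"]
      mat_exp_deriv_eigenvectors[OF sym eig eig] exp_divdiff_def)

lemma trace_mat_exp_deriv_mult_eigenbasis:
  "trace (mat_exp_deriv X H ** W) =
     (\<Sum>i\<in>UNIV. \<Sum>j\<in>UNIV. exp_divdiff (l i) (l j) * (u i \<bullet> (H *v u j)) * (u j \<bullet> (W *v u i)))"
proof -
  have "trace (mat_exp_deriv X H ** W) = (\<Sum>i\<in>UNIV. u i \<bullet> (mat_exp_deriv X H *v (W *v u i)))"
    by (simp add: trace_orthonormal_family[OF u] matrix_vector_mul_assoc)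
  then show ?thesis
    by (simp add: inner_matrix_vector_expand[OF u, of _ "mat_exp_deriv X H" "W *v _"]
        mat_exp_deriv_eigenvectors[OF sym eig eig])
qed

text \<open>
  Expanding \<open>v\<close> in the eigenbasis gives a sum of squares with positive weights \<open>exp (l j)\<close>.
\<close>

lemma inner_mat_exp_nonneg_eigenbasis: "0 \<le> v \<bullet> (mat_exp X *v v)"
proof -
  have "v \<bullet> (mat_exp X *v v) = (\<Sum>j\<in>UNIV. exp (l j) * (u j \<bullet> v)\<^sup>2)"
    unfolding inner_matrix_vector_expand[OF u, of v "mat_exp X" v] mat_exp_eigenvector[OF eig]
    by (rule sum.cong) (simp_all add: inner_commute[of v] power2_eq_square)
  then show ?thesis by (simp add: sum_nonneg)
qed

text \<open>
  Both sides are sums over pairs of eigenvectors of the squared entries \<open>q i j\<close> of \<open>V\<close>: on the left with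
  weight the divided difference of \<open>exp\<close>, on the right with weight \<open>exp (l i)\<close>. As \<open>q\<close> is symmetric, the
  latter weight may be replaced by the mean of \<open>exp (l i)\<close> and \<open>exp (l j)\<close>, which dominates.
\<close>

lemma trace_mat_exp_deriv_le_eigenbasis:
  assumes V: "symmetric_mat V"
  shows "trace (mat_exp_deriv X V ** V) \<le> trace (mat_exp X ** (V ** V))"
proof -
  define q where "q = (\<lambda>i j. (u i \<bullet> (V *v u j))\<^sup>2)"
  have q: "q i j = q j i" for i j
    unfolding q_def symmetric_mat_inner[OF V, of "u i"] by (simp add: inner_commute)
  have "trace (mat_exp_deriv X V ** V) = (\<Sum>i\<in>UNIV. \<Sum>j\<in>UNIV. exp_divdiff (l i) (l j) * q i j)"
    unfolding trace_mat_exp_deriv_mult_eigenbasis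
  proof (intro sum.cong refl)
    fix i j
    have "u j \<bullet> (V *v u i) = u i \<bullet> (V *v u j)"
      unfolding symmetric_mat_inner[OF V, of "u j"] by (rule inner_commute)
    then show "exp_divdiff (l i) (l j) * (u i \<bullet> (V *v u j)) * (u j \<bullet> (V *v u i)) = exp_divdiff (l i) (l j) * q i j"
      by (simp add: q_def power2_eq_square)
  qed
  also have "\<dots> \<le> (\<Sum>i\<in>UNIV. \<Sum>j\<in>UNIV. (exp (l i) + exp (l j)) / 2 * q i j)"
    by (intro sum_mono mult_right_mono exp_divdiff_le_mean) (simp add: q_def)
  also have "\<dots> = (\<Sum>i\<in>UNIV. \<Sum>j\<in>UNIV. exp (l i) * q i j) / 2 + (\<Sum>i\<in>UNIV. \<Sum>j\<in>UNIV. exp (l j) * q i j) / 2"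
    by (simp add: sum_divide_distrib sum.distrib[symmetric] add_divide_distrib distrib_right)
  also have "(\<Sum>i\<in>UNIV. \<Sum>j\<in>UNIV. exp (l j) * q i j) = (\<Sum>i\<in>UNIV. \<Sum>j\<in>UNIV. exp (l i) * q i j)"
    by (subst sum.swap, subst q) (rule refl)
  also have "(\<Sum>i\<in>UNIV. \<Sum>j\<in>UNIV. exp (l i) * q i j) / 2 + (\<Sum>i\<in>UNIV. \<Sum>j\<in>UNIV. exp (l i) * q i j) / 2
      = (\<Sum>i\<in>UNIV. exp (l i) * ((V *v u i) \<bullet> (V *v u i)))"
  proof -
    have "(V *v u i) \<bullet> (V *v u i) = (\<Sum>j\<in>UNIV. q i j)" for i
      unfolding orthonormal_family_inner_expand[OF u, of "V *v u i"] q[of i]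
      by (simp add: q_def power2_eq_square)
    then show ?thesis by (simp add: sum_distrib_left)
  qed
  also have "\<dots> = trace (mat_exp X ** (V ** V))"
    by (simp add: trace_mat_exp_mult_eigenbasis matrix_vector_mul_assoc[symmetric] symmetric_mat_inner[OF V, of "u _"])
  finally show ?thesis .
qed

end

lemma trace_mat_exp_pos:
  fixes X :: "real ^ 'n ^ 'n"
  assumes "symmetric_mat X" shows "0 < trace (mat_exp X)"
proof -
  obtain u l where ul: "orthonormal_family u" "\<And>i. X *v u i = l i *\<^sub>R u i"
    using symmetric_mat_spectral[OF assms] by blast
  show ?thesis by (simp add: trace_mat_exp_eigenbasis[OF assms ul] sum_pos)
qed

lemma inner_mat_exp_nonneg:
  fixes X :: "real ^ 'n ^ 'n"
  assumes "symmetric_mat X" shows "0 \<le> v \<bullet> (mat_exp X *v v)"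
proof -
  obtain u l where ul: "orthonormal_family u" "\<And>i. X *v u i = l i *\<^sub>R u i"
    using symmetric_mat_spectral[OF assms] by blast
  show ?thesis by (rule inner_mat_exp_nonneg_eigenbasis[OF assms ul])
qed

lemma trace_mat_exp_deriv:
  fixes X :: "real ^ 'n ^ 'n"
  assumes "symmetric_mat X" shows "trace (mat_exp_deriv X H) = trace (mat_exp X ** H)"
proof -
  obtain u l where ul: "orthonormal_family u" "\<And>i. X *v u i = l i *\<^sub>R u i"
    using symmetric_mat_spectral[OF assms] by blast
  show ?thesis by (rule trace_mat_exp_deriv_eigenbasis[OF assms ul])
qed

text \<open>
  This is what makes the Hessian symmetric; it holds because divided differences are symmetric.
\<close>

lemma trace_mat_exp_deriv_mult_commute:
  fixes X :: "real ^ 'n ^ 'n"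
  assumes "symmetric_mat X"
  shows "trace (mat_exp_deriv X H ** W) = trace (mat_exp_deriv X W ** H)"
proof -
  obtain u l where ul: "orthonormal_family u" "\<And>i. X *v u i = l i *\<^sub>R u i"
    using symmetric_mat_spectral[OF assms] by blast
  show ?thesis
    unfolding trace_mat_exp_deriv_mult_eigenbasis[OF assms ul]
    by (subst sum.swap, intro sum.cong refl, subst exp_divdiff_commute) simp
qed

lemma trace_mat_exp_deriv_le:
  fixes X :: "real ^ 'n ^ 'n"
  assumes "symmetric_mat X" "symmetric_mat V"
  shows "trace (mat_exp_deriv X V ** V) \<le> trace (mat_exp X ** (V ** V))"
proof -
  obtain u l where ul: "orthonormal_family u" "\<And>i. X *v u i = l i *\<^sub>R u i"
    using symmetric_mat_spectral[OF assms(1)] by blast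
  show ?thesis by (rule trace_mat_exp_deriv_le_eigenbasis[OF assms(1) ul assms(2)])
qed

section \<open>The variance bound and the largest eigenvalue\<close>

text \<open>
  Popoviciu's inequality bounds the variance by a quarter of the squared range. The two extreme values
  alone contribute at least half of the squared range to the sum on the right, whatever \<open>m\<close> is. This
  is where the factor \<open>1/2\<close> of the main result arises.
\<close>

lemma variance_le_half_sum_sq:
  fixes p mu :: "'n::finite \<Rightarrow> real"
  assumes nonneg: "\<And>k. 0 \<le> p k" and total: "(\<Sum>k\<in>UNIV. p k) = 1"
  shows "(\<Sum>k\<in>UNIV. p k * (mu k)\<^sup>2) - (\<Sum>k\<in>UNIV. p k * mu k)\<^sup>2 \<le> (1/2) * (\<Sum>k\<in>UNIV. (mu k - m)\<^sup>2)"
proof -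
  have "Max (range mu) \<in> range mu" by (rule Max_in) auto
  then obtain i where "mu i = Max (range mu)" by (metis imageE)
  then have i: "mu k \<le> mu i" for k by (simp add: Max_ge)
  have "Min (range mu) \<in> range mu" by (rule Min_in) auto
  then obtain j where "mu j = Min (range mu)" by (metis imageE)
  then have j: "mu j \<le> mu k" for k by (simp add: Min_le)
  \<comment> \<open>Centering at the midpoint of the range instead of at the mean can only increase the second moment.\<close>
  define c where "c = (mu i + mu j) / 2"
  let ?E = "\<Sum>k\<in>UNIV. p k * mu k"
  have "(\<Sum>k\<in>UNIV. p k * (mu k - c)\<^sup>2) = (\<Sum>k\<in>UNIV. p k * (mu k)\<^sup>2 - 2 * c * (p k * mu k) + c\<^sup>2 * p k)"
    by (rule sum.cong) (simp_all add: power2_eq_square algebra_simps)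
  also have "\<dots> = (\<Sum>k\<in>UNIV. p k * (mu k)\<^sup>2) - 2 * c * ?E + c\<^sup>2"
    by (simp add: sum.distrib sum_subtractf sum_distrib_left[symmetric] total)
  finally have "(\<Sum>k\<in>UNIV. p k * (mu k)\<^sup>2) - ?E\<^sup>2 = (\<Sum>k\<in>UNIV. p k * (mu k - c)\<^sup>2) - (?E - c)\<^sup>2"
    by (simp add: power2_eq_square algebra_simps)
  also have "\<dots> \<le> (\<Sum>k\<in>UNIV. p k * (mu k - c)\<^sup>2)" by simp
  also have "\<dots> \<le> (\<Sum>k\<in>UNIV. p k * ((mu i - mu j) / 2)\<^sup>2)"
  proof (intro sum_mono mult_left_mono nonneg)
    fix k
    have "\<bar>mu k - c\<bar> \<le> \<bar>(mu i - mu j) / 2\<bar>" using i[of k] j[of k] by (simp add: c_def abs_le_iff field_simps)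
    then show "(mu k - c)\<^sup>2 \<le> ((mu i - mu j) / 2)\<^sup>2" by (simp only: abs_le_square_iff)
  qed
  also have "\<dots> = (mu i - mu j)\<^sup>2 / 4"
    unfolding sum_distrib_right[symmetric] total by (simp add: power_divide)
  also have "\<dots> \<le> (1/2) * (\<Sum>k\<in>UNIV. (mu k - m)\<^sup>2)"
  proof (cases "i = j")
    case False
    \<comment> \<open>The parallelogram identity for the two deviations from \<open>m\<close>.\<close>
    have "(mu i - mu j)\<^sup>2 + (mu i + mu j - 2 * m)\<^sup>2 = 2 * ((mu i - m)\<^sup>2 + (mu j - m)\<^sup>2)"
      by (simp add: power2_eq_square algebra_simps)
    then have "(mu i - mu j)\<^sup>2 \<le> 2 * ((mu i - m)\<^sup>2 + (mu j - m)\<^sup>2)"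
      using zero_le_power2[of "mu i + mu j - 2 * m"] by linarith
    also have "(mu i - m)\<^sup>2 + (mu j - m)\<^sup>2 = (\<Sum>k\<in>{i, j}. (mu k - m)\<^sup>2)" using False by simp
    also have "\<dots> \<le> (\<Sum>k\<in>UNIV. (mu k - m)\<^sup>2)" by (rule sum_mono2) auto
    finally show ?thesis by simp
  qed (simp add: sum_nonneg)
  finally show ?thesis .
qed

text \<open>
  The matrix \<open>exp X / Z\<close> is positive semidefinite of trace 1, so its diagonal in an eigenbasis of \<open>V\<close> is a
  probability vector \<open>p\<close>. On the left is the variance of the eigenvalues of \<open>V\<close> under \<open>p\<close>; on the right
  is the sum of the squared eigenvalues of \<open>V\<close> after the shift by their mean.
\<close>

lemma gibbs_variance_le:
  fixes X V :: "real ^ 'n ^ 'n"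
  assumes X: "symmetric_mat X" and V: "symmetric_mat V"
  defines "Z \<equiv> trace (mat_exp X)"
  shows "trace (mat_exp X ** (V ** V)) / Z - (trace (mat_exp X ** V) / Z)\<^sup>2
           \<le> (1/2) * trace (centered V ** centered V)"
proof -
  obtain w mu where w: "orthonormal_family w" and mu: "\<And>k. V *v w k = mu k *\<^sub>R w k"
    using symmetric_mat_spectral[OF V] by blast
  define p where "p = (\<lambda>k. (w k \<bullet> (mat_exp X *v w k)) / Z)"
  define m where "m = trace V / real CARD('n)"
  have Z: "Z > 0" unfolding Z_def by (rule trace_mat_exp_pos[OF X])
  have "trace (mat_exp X ** V) / Z = (\<Sum>k\<in>UNIV. p k * mu k)"
    by (simp add: trace_orthonormal_family[OF w] matrix_vector_mul_assoc[symmetric] mu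
        matrix_vector_mult_scaleR p_def sum_divide_distrib mult.commute)
  moreover have "trace (mat_exp X ** (V ** V)) / Z = (\<Sum>k\<in>UNIV. p k * (mu k)\<^sup>2)"
    by (simp add: trace_orthonormal_family[OF w] matrix_vector_mul_assoc[symmetric] mu
        matrix_vector_mult_scaleR p_def sum_divide_distrib power2_eq_square mult.commute mult.left_commute)
  moreover have "(\<Sum>k\<in>UNIV. p k) = 1"
    using Z unfolding p_def sum_divide_distrib[symmetric] trace_orthonormal_family[OF w, symmetric]
    by (simp add: Z_def)
  moreover have "0 \<le> p k" for k
    using Z inner_mat_exp_nonneg[OF X] by (simp add: p_def)
  moreover have "centered V *v w k = (mu k - m) *\<^sub>R w k" for k
    by (simp add: centered_def m_def matrix_vector_mult_diff_rdistrib scaleR_matrix_vector_assoc[symmetric]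
        mu scaleR_diff_left)
  then have "trace (centered V ** centered V) = (\<Sum>k\<in>UNIV. (mu k - m)\<^sup>2)"
    by (simp add: trace_orthonormal_family[OF w] matrix_vector_mul_assoc[symmetric]
        matrix_vector_mult_scaleR orthonormal_family_inner[OF w] power2_eq_square)
  ultimately show ?thesis using variance_le_half_sum_sq[of p mu m] by simp
qed

text \<open>
  The spectral theorem also shows that the spectrum is finite and nonempty: an eigenvector has a
  nonzero coefficient at some basis vector, and its eigenvalue is then the one belonging to it. Hence
  the maximum in \<^const>\<open>lambda_max\<close> bounds every eigenvalue.
\<close>

lemma symmetric_mat_le_lambda_max:
  fixes G :: "real ^ 'n ^ 'n"
  assumes "symmetric_mat G"
  shows "v \<bullet> (G *v v) \<le> lambda_max G * (v \<bullet> v)"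
proof -
  obtain u l where u: "orthonormal_family u" and l: "\<And>i. G *v u i = l i *\<^sub>R u i"
    using symmetric_mat_spectral[OF assms] by blast
  have "eigenvalues G \<subseteq> range l"
  proof
    fix c assume "c \<in> eigenvalues G"
    then obtain x where x: "x \<noteq> 0" "G *v x = c *\<^sub>R x" by (auto simp: eigenvalues_def)
    have "\<exists>i. u i \<bullet> x \<noteq> 0"
    proof (rule ccontr)
      assume "\<nexists>i. u i \<bullet> x \<noteq> 0"
      then have "x = 0" using orthonormal_family_expand[OF u, of x] by simp
      with x show False by simp
    qed
    then obtain i where i: "u i \<bullet> x \<noteq> 0" by blast
    have "c * (u i \<bullet> x) = l i * (u i \<bullet> x)"
      using symmetric_mat_inner[OF assms, of "u i" x] x by (simp add: l)
    with i show "c \<in> range l" by simp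
  qed
  then have fin: "finite (eigenvalues G)" by (rule finite_subset) simp
  have "l i \<in> eigenvalues G" for i
  proof -
    have "u i \<noteq> 0" using orthonormal_family_inner[OF u, of i i] by auto
    then show ?thesis using l by (auto simp: eigenvalues_def)
  qed
  then have "l i \<le> lambda_max G" for i unfolding lambda_max_def using fin by (intro Max_ge)
  then have "(\<Sum>i\<in>UNIV. l i * (u i \<bullet> v)\<^sup>2) \<le> (\<Sum>i\<in>UNIV. lambda_max G * (u i \<bullet> v)\<^sup>2)"
    by (intro sum_mono mult_right_mono) auto
  moreover have "v \<bullet> (G *v v) = (\<Sum>i\<in>UNIV. l i * (u i \<bullet> v)\<^sup>2)"
    unfolding inner_matrix_vector_expand[OF u, of v G v] l
    by (rule sum.cong) (simp_all add: inner_commute[of v] power2_eq_square)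
  moreover have "lambda_max G * (v \<bullet> v) = (\<Sum>i\<in>UNIV. lambda_max G * (u i \<bullet> v)\<^sup>2)"
    by (simp add: orthonormal_family_inner_expand[OF u, of v v] sum_distrib_left power2_eq_square)
  ultimately show ?thesis by simp
qed

section \<open>The gradient and the Hessian\<close>

lemma symmetric_mat_mat_comb:
  assumes "\<And>i. symmetric_mat (A i)" shows "symmetric_mat (mat_comb A y)"
  using assms by (simp add: symmetric_mat_def mat_comb_def transpose_def vec_eq_iff)

lemma bounded_linear_mat_comb: "bounded_linear (mat_comb A)"
  unfolding linear_conv_bounded_linear[symmetric]
  by (rule linearI)
    (simp_all add: mat_comb_def scaleR_add_left sum.distrib scaleR_sum_right)

lemma mat_comb_axis: "mat_comb A (axis i 1) = A i"
proof -
  have "mat_comb A (axis i 1) = (\<Sum>j\<in>UNIV. if j = i then A j else 0)"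
    unfolding mat_comb_def by (rule sum.cong) (auto simp: axis_def)
  then show ?thesis by simp
qed

lemma bounded_linear_trace_mult:
  fixes Y :: "real ^ 'n ^ 'n"
  shows "bounded_linear (\<lambda>W :: real ^ 'n ^ 'n. trace (Y ** W))"
  by (rule bounded_linear_compose[OF bounded_linear_trace
        bounded_bilinear.bounded_linear_right[OF bounded_bilinear_matrix_mult]])

lemma trace_mult_mat_comb:
  fixes Y :: "real ^ 'n ^ 'n"
  shows "trace (Y ** mat_comb A v) = (\<Sum>i\<in>UNIV. v $ i * trace (Y ** A i))"
proof -
  interpret bounded_linear "\<lambda>W :: real ^ 'n ^ 'n. trace (Y ** W)" by (rule bounded_linear_trace_mult)
  show ?thesis unfolding mat_comb_def sum scale by simp
qed

text \<open>
  Centering is linear, so the quadratic form of the Gram matrix at \<open>v\<close> is the squared Frobenius norm of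
  one centered matrix, the combination with coefficients \<open>v\<close>.
\<close>

lemma centered_mat_comb: "centered (mat_comb A v) = mat_comb (\<lambda>i. centered (A i)) v"
proof -
  have "trace (mat_comb A v) = (\<Sum>i\<in>UNIV. v $ i * trace (A i))"
    using trace_mult_mat_comb[of "mat 1" A v] by simp
  then show ?thesis
    unfolding centered_def
    by (simp add: sum_divide_distrib scaleR_sum_left)
      (simp add: mat_comb_def scaleR_diff_right sum_subtractf)
qed

lemma symmetric_mat_centered_gram: "symmetric_mat (centered_gram A)"
proof -
  have "trace (centered (A i) ** centered (A j)) = trace (centered (A j) ** centered (A i))" for i j
    by (rule trace_mul_sym)
  then show ?thesis by (simp add: symmetric_mat_def centered_gram_def transpose_def vec_eq_iff)
qed

lemma centered_gram_form:
  "v \<bullet> (centered_gram A *v v) = trace (centered (mat_comb A v) ** centered (mat_comb A v))"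
proof -
  let ?C = "mat_comb (\<lambda>i. centered (A i)) v"
  have "trace (?C ** ?C) = (\<Sum>i\<in>UNIV. v $ i * trace (?C ** centered (A i)))"
    by (rule trace_mult_mat_comb)
  also have "\<dots> = (\<Sum>i\<in>UNIV. v $ i * trace (centered (A i) ** ?C))"
    by (subst trace_mul_sym) (rule refl)
  also have "\<dots> = v \<bullet> (centered_gram A *v v)"
    unfolding trace_mult_mat_comb
    by (simp add: inner_vec_def matrix_vector_mult_def centered_gram_def mult.commute)
  finally show ?thesis by (simp add: centered_mat_comb)
qed

lemma has_derivative_vec_nth:
  fixes f :: "'a::real_normed_vector \<Rightarrow> real ^ 'm"
  assumes "\<And>i. ((\<lambda>x. f x $ i) has_derivative (\<lambda>h. f' h $ i)) (at x within S)"
  shows "(f has_derivative f') (at x within S)"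
  unfolding has_derivative_componentwise_within[of f]
  using assms by (auto simp: Basis_vec_def inner_axis)

text \<open>
  The derivative of the gradient in direction \<open>h\<close>, as given by the quotient rule. Its entries are the
  Bogoliubov--Kubo--Mori covariances of \<open>A i\<close> and \<open>mat_comb A h\<close> in the Gibbs state \<open>exp X / Z\<close>.
\<close>

definition gibbs_covariance :: "('m::finite \<Rightarrow> real ^ 'n ^ 'n) \<Rightarrow> real ^ 'm \<Rightarrow> real ^ 'm \<Rightarrow> real ^ 'm" where
  "gibbs_covariance A y h =
     (\<chi> i. trace (mat_exp_deriv (mat_comb A y) (mat_comb A h) ** A i) / trace (mat_exp (mat_comb A y))
       - trace (mat_exp (mat_comb A y) ** A i) * trace (mat_exp (mat_comb A y) ** mat_comb A h)
           / (trace (mat_exp (mat_comb A y)))\<^sup>2)"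

context
  fixes A :: "'m::finite \<Rightarrow> real ^ 'n ^ 'n" and b :: "real ^ 'm"
  assumes sym: "\<And>i. symmetric_mat (A i)"
begin

lemma has_derivative_trace_mat_exp_mat_comb:
  "((\<lambda>y. trace (mat_exp (mat_comb A y) ** W)) has_derivative
     (\<lambda>h. trace (mat_exp_deriv (mat_comb A y) (mat_comb A h) ** W))) (at y)"
proof -
  have "bounded_linear (\<lambda>Y :: real ^ 'n ^ 'n. trace (Y ** W))"
    by (rule bounded_linear_compose[OF bounded_linear_trace
          bounded_bilinear.bounded_linear_left[OF bounded_bilinear_matrix_mult]])
  moreover have "((\<lambda>y. mat_exp (mat_comb A y)) has_derivative
      (\<lambda>h. mat_exp_deriv (mat_comb A y) (mat_comb A h))) (at y)"
    by (rule has_derivative_compose[OF bounded_linear_imp_has_derivative[OF bounded_linear_mat_comb]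
          has_derivative_mat_exp])
  ultimately show ?thesis by (rule bounded_linear.has_derivative)
qed

lemma has_derivative_log_tr_exp:
  "(log_tr_exp A b has_derivative
     (\<lambda>h. trace (mat_exp (mat_comb A y) ** mat_comb A h) / trace (mat_exp (mat_comb A y)) - b \<bullet> h)) (at y)"
proof -
  let ?X = "mat_comb A y"
  have X: "symmetric_mat ?X" by (rule symmetric_mat_mat_comb[OF sym])
  have "((\<lambda>y. trace (mat_exp (mat_comb A y))) has_derivative
      (\<lambda>h. trace (mat_exp ?X ** mat_comb A h))) (at y)"
    using has_derivative_trace_mat_exp_mat_comb[of "mat 1" y] by (simp add: trace_mat_exp_deriv[OF X])
  then have "((\<lambda>y. ln (trace (mat_exp (mat_comb A y))) - b \<bullet> y) has_derivative
      (\<lambda>h. trace (mat_exp ?X ** mat_comb A h) * inverse (trace (mat_exp ?X)) - b \<bullet> h)) (at y)"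
    using trace_mat_exp_pos[OF X]
    by (intro has_derivative_diff has_derivative_ln has_derivative_inner_right has_derivative_ident) auto
  then show ?thesis by (simp add: log_tr_exp_def[abs_def] divide_inverse)
qed

lemma gradient_log_tr_exp:
  "gradient (log_tr_exp A b) =
     (\<lambda>y. \<chi> i. trace (mat_exp (mat_comb A y) ** A i) / trace (mat_exp (mat_comb A y)) - b $ i)"
proof
  fix y
  show "gradient (log_tr_exp A b) y =
     (\<chi> i. trace (mat_exp (mat_comb A y) ** A i) / trace (mat_exp (mat_comb A y)) - b $ i)"
    by (simp add: gradient_def frechet_derivative_at[OF has_derivative_log_tr_exp, symmetric]
        mat_comb_axis inner_axis)
qed

lemma has_derivative_gradient_log_tr_exp:
  "(gradient (log_tr_exp A b) has_derivative gibbs_covariance A y) (at y)"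
proof (rule has_derivative_vec_nth)
  fix i
  let ?X = "mat_comb A y"
  have X: "symmetric_mat ?X" by (rule symmetric_mat_mat_comb[OF sym])
  have Z: "trace (mat_exp ?X) \<noteq> 0" using trace_mat_exp_pos[OF X] by simp
  have "((\<lambda>y. trace (mat_exp (mat_comb A y))) has_derivative
      (\<lambda>h. trace (mat_exp ?X ** mat_comb A h))) (at y)"
    using has_derivative_trace_mat_exp_mat_comb[of "mat 1" y] by (simp add: trace_mat_exp_deriv[OF X])
  from has_derivative_divide'[OF has_derivative_trace_mat_exp_mat_comb[of "A i"] this Z]
  have "((\<lambda>y. trace (mat_exp (mat_comb A y) ** A i) / trace (mat_exp (mat_comb A y)) - b $ i) has_derivative
      (\<lambda>h. (trace (mat_exp_deriv ?X (mat_comb A h) ** A i) * trace (mat_exp ?X)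
        - trace (mat_exp ?X ** A i) * trace (mat_exp ?X ** mat_comb A h)) / (trace (mat_exp ?X) * trace (mat_exp ?X)) - 0)) (at y)"
    by (intro has_derivative_diff has_derivative_const)
  moreover have "(trace (mat_exp_deriv ?X (mat_comb A h) ** A i) * trace (mat_exp ?X)
        - trace (mat_exp ?X ** A i) * trace (mat_exp ?X ** mat_comb A h)) / (trace (mat_exp ?X) * trace (mat_exp ?X)) - 0
      = gibbs_covariance A y h $ i" for h
    using Z by (simp add: gibbs_covariance_def diff_divide_distrib power2_eq_square)
  ultimately show "((\<lambda>y. gradient (log_tr_exp A b) y $ i) has_derivative (\<lambda>h. gibbs_covariance A y h $ i)) (at y)"
    by (simp add: gradient_log_tr_exp)
qed

lemma hessian_log_tr_exp: "hessian (log_tr_exp A b) y = matrix (gibbs_covariance A y)"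
  unfolding hessian_def jacobian_def
  by (simp add: frechet_derivative_at[OF has_derivative_gradient_log_tr_exp, symmetric])

lemma symmetric_mat_hessian_log_tr_exp: "symmetric_mat (hessian (log_tr_exp A b) y)"
proof -
  have "trace (mat_exp_deriv (mat_comb A y) (A i) ** A j) = trace (mat_exp_deriv (mat_comb A y) (A j) ** A i)" for i j
    by (rule trace_mat_exp_deriv_mult_commute[OF symmetric_mat_mat_comb[OF sym]])
  then show ?thesis
    by (simp add: hessian_log_tr_exp symmetric_mat_def transpose_def vec_eq_iff matrix_def
        gibbs_covariance_def mat_comb_axis mult.commute)
qed

lemma hessian_log_tr_exp_form:
  defines "E \<equiv> \<lambda>y. mat_exp (mat_comb A y)"
  shows "v \<bullet> (hessian (log_tr_exp A b) y *v v) =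
    trace (mat_exp_deriv (mat_comb A y) (mat_comb A v) ** mat_comb A v) / trace (E y)
      - (trace (E y ** mat_comb A v) / trace (E y))\<^sup>2"
proof -
  have "linear (gibbs_covariance A y)"
    using has_derivative_gradient_log_tr_exp has_derivative_linear by blast
  then have "hessian (log_tr_exp A b) y *v v = gibbs_covariance A y v"
    unfolding hessian_log_tr_exp linear_matrix_vector_mul_eq[symmetric] by (rule matrix_works)
  then have "v \<bullet> (hessian (log_tr_exp A b) y *v v) = (\<Sum>i\<in>UNIV. v $ i * gibbs_covariance A y v $ i)"
    by (simp add: inner_vec_def)
  also have "\<dots> = (\<Sum>i\<in>UNIV. v $ i * trace (mat_exp_deriv (mat_comb A y) (mat_comb A v) ** A i)) / trace (E y)
      - (\<Sum>i\<in>UNIV. v $ i * trace (E y ** A i)) * trace (E y ** mat_comb A v) / (trace (E y))\<^sup>2"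
    by (simp add: gibbs_covariance_def E_def right_diff_distrib sum_subtractf sum_divide_distrib
        sum_distrib_right mult.assoc)
  also have "\<dots> = trace (mat_exp_deriv (mat_comb A y) (mat_comb A v) ** mat_comb A v) / trace (E y)
      - (trace (E y ** mat_comb A v) / trace (E y))\<^sup>2"
    unfolding trace_mult_mat_comb[symmetric] by (simp add: power_divide power2_eq_square)
  finally show ?thesis .
qed

text \<open>
  The second derivative along \<open>v\<close> is at most the ordinary variance of \<open>V = mat_comb A v\<close> in the Gibbs
  state, and that variance is at most half the squared Frobenius norm of the centered \<open>V\<close>.
\<close>

lemma hessian_log_tr_exp_le:
  "v \<bullet> (hessian (log_tr_exp A b) y *v v) \<le> (1/2) * (v \<bullet> (centered_gram A *v v))"
proof -
  let ?X = "mat_comb A y" and ?V = "mat_comb A v"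
  have X: "symmetric_mat ?X" and V: "symmetric_mat ?V" by (rule symmetric_mat_mat_comb[OF sym])+
  have "v \<bullet> (hessian (log_tr_exp A b) y *v v)
      \<le> trace (mat_exp ?X ** (?V ** ?V)) / trace (mat_exp ?X) - (trace (mat_exp ?X ** ?V) / trace (mat_exp ?X))\<^sup>2"
    unfolding hessian_log_tr_exp_form
    using trace_mat_exp_deriv_le[OF X V] trace_mat_exp_pos[OF X]
    by (intro diff_right_mono divide_right_mono) auto
  also have "\<dots> \<le> (1/2) * (v \<bullet> (centered_gram A *v v))"
    unfolding centered_gram_form by (rule gibbs_variance_le[OF X V])
  finally show ?thesis .
qed

end

section \<open>The Loewner bounds\<close>

lemma loewner_leI:
  assumes "symmetric_mat X" "symmetric_mat Y" "\<And>v. v \<bullet> (X *v v) \<le> v \<bullet> (Y *v v)"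
  shows "X \<preceq>\<^sub>L Y"
proof -
  have "symmetric_mat (Y - X)"
    using assms(1,2) by (simp add: symmetric_mat_def transpose_def vec_eq_iff)
  then show ?thesis
    using assms by (simp add: loewner_le_def psd_def matrix_vector_mult_diff_rdistrib inner_diff_right)
qed

lemma symmetric_mat_scaleR: "symmetric_mat X \<Longrightarrow> symmetric_mat (c *\<^sub>R X)"
  by (simp add: symmetric_mat_def transpose_scalar)

theorem lemma6:
  fixes A :: "'m::finite \<Rightarrow> real ^ 'n ^ 'n" and b :: "real ^ 'm"
  assumes sym: "\<And>i. symmetric_mat (A i)"
    and inj: "inj A"
    and id_notin: "mat 1 \<notin> range A"
    and indep: "independent (insert (mat 1) (range A))"
  shows "twice_differentiable (log_tr_exp A b)
       \<and> (\<forall>y. hessian (log_tr_exp A b) y \<preceq>\<^sub>L (1/2) *\<^sub>R centered_gram A)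
       \<and> L_smooth (1/2 * lambda_max (centered_gram A)) (log_tr_exp A b)"
proof -
  have diff: "twice_differentiable (log_tr_exp A b)"
    unfolding twice_differentiable_def differentiable_def
    using has_derivative_log_tr_exp[where A = A] has_derivative_gradient_log_tr_exp[where A = A] sym by blast
  have gram: "hessian (log_tr_exp A b) y \<preceq>\<^sub>L (1/2) *\<^sub>R centered_gram A" for y
    using hessian_log_tr_exp_le[of A, OF sym]
    by (intro loewner_leI symmetric_mat_scaleR symmetric_mat_centered_gram symmetric_mat_hessian_log_tr_exp sym)
      (simp add: scaleR_matrix_vector_assoc[symmetric])
  have "hessian (log_tr_exp A b) y \<preceq>\<^sub>L (1/2 * lambda_max (centered_gram A)) *\<^sub>R mat 1" for y
  proof (intro loewner_leI symmetric_mat_scaleR symmetric_mat_hessian_log_tr_exp sym)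
    fix v
    have "v \<bullet> (hessian (log_tr_exp A b) y *v v) \<le> (1/2) * (v \<bullet> (centered_gram A *v v))"
      by (rule hessian_log_tr_exp_le[OF sym])
    also have "\<dots> \<le> (1/2) * (lambda_max (centered_gram A) * (v \<bullet> v))"
      by (intro mult_left_mono symmetric_mat_le_lambda_max symmetric_mat_centered_gram) simp
    finally show "v \<bullet> (hessian (log_tr_exp A b) y *v v)
        \<le> v \<bullet> (((1/2 * lambda_max (centered_gram A)) *\<^sub>R mat 1) *v v)"
      by (simp add: scaleR_matrix_vector_assoc[symmetric])
  qed (simp add: symmetric_mat_def)
  with diff gram show ?thesis by (simp add: L_smooth_def)
qed

end
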